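(* Let $n\ge 2$ and let $\Lambda$ be the preprojective algebra of type $A_{n-1}$. Let $i\in\{1,\dots,n-1\}$ and let $M$ be a $\Lambda$-module whose socle is isomorphic to the simple module $S_i$, with dimension vector $v$. Let $A$ be an $i$-element subset of $\{1,\dots,n\}$ such that $\alpha_v=1_{\{1,\dots,i\}}-1_A$. Then $M$ is isomorphic, as a $\Lambda$-module, to the Maya module $N(A)$.
   Context: Fix a ground field. Let $I=\{1,\dots,n-1\}$. A (finite-dimensional) $\Lambda$-module is an $I$-graded finite-dimensional vector space $M=\bigoplus_{i\in I}M_i$ with linear maps $(i\to i+1):M_i\to M_{i+1}$ (for $1\le i\le n-2$) and $(i\to i-1):M_i\to M_{i-1}$ (for $2\le i\le n-1$) satisfying, for every $i\in I$, $$(i+1\to i)\circ(i\to i+1)=(i-1\to i)\circ(i\to i-1)\quad\text{on } M_i,$$ with the convention $M_0=M_n=0$, so that $(1\to 0)$ and $(n-1\to n)$ are zero. Homomorphisms are graded linear maps commuting with all these maps. The simple module $S_i$ is one-dimensional, concentrated in degree $i$, with all maps zero. The socle of $M$ is its largest semisimple submodule; its degree $j$ piece is $\{w\in M_j:(j\to j+1)(w)=0=(j\to j-1)(w)\}$. The dimension vector of $M$ is $v=(v_j)_{j\in I}$ with $v_j=\dim M_j$, and $\alpha_v=\sum_{j\in I}v_j\alpha_j\in\mathbb{Z}^n$, where $\alpha_j=e_j-e_{j+1}$ ($e_1,\dots,e_n$ the standard basis). For $A\subseteq\{1,\dots,n\}$, $1_A\in\mathbb{Z}^n$ is the indicator vector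 of $A$. Maya modules: let $A=\{a_1<\dots<a_i\}$ be a proper subset of $\{1,\dots,n\}$ of size $i$ with $A\ne\{1,\dots,i\}$. $N(A)$ has basis $\{w_{j,k}: 1\le k\le i,\ k\le j\le a_k-1\}$ with $w_{j,k}\in N(A)_j$, and $$(j\to j-1)(w_{j,k})=w_{j-1,k},\qquad (j\to j+1)(w_{j,k})=w_{j+1,k+1},$$ where $w_{j,k}$ is interpreted as $0$ whenever $(j,k)$ is not in the index set of the basis. *)

theory Defs
  imports Complex_Main "HOL-Library.Function_Algebras" "HOL-Library.Indicator_Function"
begin

text \<open>
  Candidate modules over the preprojective algebra. The graded pieces are subspaces of one ambient
  vector space, but the pieces are not required to be independent in it: the module is the
  external direct sum of the family \<open>piece M\<close>. The maps \<open>(j \<rightarrow> j+1)\<close> and \<open>(j \<rightarrow> j-1)\<close> are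
  \<open>up M j\<close> and \<open>down M j\<close>; only their values on \<open>piece M j\<close> matter.
\<close>

record ('k, 'a) graded_rep =
  smul :: "'k \<Rightarrow> 'a \<Rightarrow> 'a"
  piece :: "nat \<Rightarrow> 'a set"
  up :: "nat \<Rightarrow> 'a \<Rightarrow> 'a"
  down :: "nat \<Rightarrow> 'a \<Rightarrow> 'a"

definition linear_between ::
  "('k \<Rightarrow> 'a::ab_group_add \<Rightarrow> 'a) \<Rightarrow> ('k \<Rightarrow> 'b::ab_group_add \<Rightarrow> 'b) \<Rightarrow> 'a set \<Rightarrow> 'b set \<Rightarrow> ('a \<Rightarrow> 'b) \<Rightarrow> bool"
  where
  "linear_between s t U V f \<longleftrightarrow>
     (\<forall>x\<in>U. f x \<in> V) \<and>
     (\<forall>x\<in>U. \<forall>y\<in>U. f (x + y) = f x + f y) \<and>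
     (\<forall>c. \<forall>x\<in>U. f (s c x) = t c (f x))"

text \<open>
  The pieces vanish outside \<open>I = {1..n-1}\<close>, in particular \<open>M\<^sub>0 = M\<^sub>n = 0\<close>. Linearity
  is asked at every index for uniformity; outside \<open>I\<close>, and at the boundary maps \<open>(1 \<rightarrow> 0)\<close>
  and \<open>(n-1 \<rightarrow> n)\<close>, it only says that the map is zero.
\<close>

definition preproj_module ::
  "nat \<Rightarrow> ('k::field, 'a::ab_group_add) graded_rep \<Rightarrow> bool" where
  "preproj_module n M \<longleftrightarrow>
     vector_space (smul M) \<and>
     (\<forall>j. module.subspace (smul M) (piece M j)) \<and>
     (\<forall>j. \<exists>B. finite B \<and> piece M j = module.span (smul M) B) \<and>
     (\<forall>j. j \<notin> {1..n-1} \<longrightarrow> piece M j = {0}) \<and>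
     (\<forall>j. linear_between (smul M) (smul M) (piece M j) (piece M (j + 1)) (up M j)) \<and>
     (\<forall>j. linear_between (smul M) (smul M) (piece M (j + 1)) (piece M j) (down M (j + 1))) \<and>
     (\<forall>j\<in>{1..n-1}. \<forall>x\<in>piece M j. down M (j + 1) (up M j x) = up M (j - 1) (down M j x))"

definition module_hom ::
  "('k, 'a::ab_group_add) graded_rep \<Rightarrow> ('k, 'b::ab_group_add) graded_rep \<Rightarrow> (nat \<Rightarrow> 'a \<Rightarrow> 'b) \<Rightarrow> bool"
  where
  "module_hom M N \<phi> \<longleftrightarrow>
     (\<forall>j. linear_between (smul M) (smul N) (piece M j) (piece N j) (\<phi> j)) \<and>
     (\<forall>j. \<forall>x\<in>piece M j. \<phi> (j + 1) (up M j x) = up N j (\<phi> j x)) \<and>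
     (\<forall>j. \<forall>x\<in>piece M (j + 1). \<phi> j (down M (j + 1) x) = down N (j + 1) (\<phi> (j + 1) x))"

definition module_iso ::
  "('k, 'a::ab_group_add) graded_rep \<Rightarrow> ('k, 'b::ab_group_add) graded_rep \<Rightarrow> bool" where
  "module_iso M N \<longleftrightarrow>
     (\<exists>\<phi>. module_hom M N \<phi> \<and> (\<forall>j. bij_betw (\<phi> j) (piece M j) (piece N j)))"


definition submodule ::
  "(nat \<Rightarrow> 'a set) \<Rightarrow> ('k::field, 'a::ab_group_add) graded_rep \<Rightarrow> bool" where
  "submodule U M \<longleftrightarrow>
     (\<forall>j. module.subspace (smul M) (U j) \<and> U j \<subseteq> piece M j) \<and>
     (\<forall>j. \<forall>x\<in>U j. up M j x \<in> U (j + 1)) \<and>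
     (\<forall>j. \<forall>x\<in>U (j + 1). down M (j + 1) x \<in> U j)"

definition restrict_to ::
  "('k, 'a) graded_rep \<Rightarrow> (nat \<Rightarrow> 'a set) \<Rightarrow> ('k, 'a) graded_rep" where
  "restrict_to M U = M\<lparr>piece := U\<rparr>"

definition simple_module :: "('k::field, 'a::ab_group_add) graded_rep \<Rightarrow> bool" where
  "simple_module M \<longleftrightarrow>
     (\<exists>j. piece M j \<noteq> {0}) \<and>
     (\<forall>U. submodule U M \<longrightarrow> (\<forall>j. U j = {0}) \<or> U = piece M)"

text \<open>Semisimple means being the sum of the simple submodules.\<close>

definition semisimple_module :: "('k::field, 'a::ab_group_add) graded_rep \<Rightarrow> bool" where
  "semisimple_module M \<longleftrightarrow>
     (\<forall>j. piece M j =
        module.span (smul M) (\<Union>{U j | U. submodule U M \<and> simple_module (restrict_to M U)}))"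

definition is_socle ::
  "(nat \<Rightarrow> 'a set) \<Rightarrow> ('k::field, 'a::ab_group_add) graded_rep \<Rightarrow> bool" where
  "is_socle U M \<longleftrightarrow>
     submodule U M \<and> semisimple_module (restrict_to M U) \<and>
     (\<forall>V. submodule V M \<and> semisimple_module (restrict_to M V) \<longrightarrow> (\<forall>j. V j \<subseteq> U j))"

definition simple_at :: "nat \<Rightarrow> ('k::field, 'k) graded_rep" where
  "simple_at i =
     \<lparr>smul = (*), piece = (\<lambda>j. if j = i then UNIV else {0}), up = (\<lambda>_ _. 0), down = (\<lambda>_ _. 0)\<rparr>"

definition dim_vector :: "('k::field, 'a::ab_group_add) graded_rep \<Rightarrow> nat \<Rightarrow> nat" where
  "dim_vector M j = vector_space.dim (smul M) (piece M j)"


text \<open>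
  Vectors in \<open>\<int>\<^sup>n\<close> are functions \<open>nat \<Rightarrow> int\<close> supported in \<open>{1..n}\<close>, and the indicator function
  of a singleton \<open>{j}\<close> is the standard basis vector \<open>e\<^sub>j\<close>.
\<close>

definition simple_root :: "nat \<Rightarrow> nat \<Rightarrow> int" where
  "simple_root j = indicator {j} - indicator {j + 1}"

definition root_combination :: "nat \<Rightarrow> (nat \<Rightarrow> nat) \<Rightarrow> nat \<Rightarrow> int" where
  "root_combination n v = (\<lambda>m. \<Sum>j=1..n-1. int (v j) * simple_root j m)"


text \<open>\<open>kth_element A k\<close> is \<open>a\<^sub>k\<close> for \<open>A = {a\<^sub>1 < \<dots> < a\<^sub>i}\<close>, counting from 1.\<close>

definition kth_element :: "nat set \<Rightarrow> nat \<Rightarrow> nat" where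
  "kth_element A k = sorted_list_of_set A ! (k - 1)"

definition maya_index :: "nat set \<Rightarrow> (nat \<times> nat) set" where
  "maya_index A = {(j, k). 1 \<le> k \<and> k \<le> card A \<and> k \<le> j \<and> j \<le> kth_element A k - 1}"

definition maya_basis :: "nat set \<Rightarrow> nat \<Rightarrow> nat \<Rightarrow> nat \<times> nat \<Rightarrow> 'k::field" where
  "maya_basis A j k = (if (j, k) \<in> maya_index A then indicator {(j, k)} else 0)"

text \<open>
  An element \<open>f\<close> of \<open>N(A)\<^sub>j\<close> is the coordinate function of \<open>\<Sum>k. f (j, k) w\<^sub>j\<^sub>,\<^sub>k\<close>; the maps below
  are the linear extensions of the rules for the basis vectors.
\<close>

definition maya_smul :: "'k::field \<Rightarrow> (nat \<times> nat \<Rightarrow> 'k) \<Rightarrow> nat \<times> nat \<Rightarrow> 'k" where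
  "maya_smul c f = (\<lambda>p. c * f p)"

definition maya_module :: "nat set \<Rightarrow> ('k::field, nat \<times> nat \<Rightarrow> 'k) graded_rep" where
  "maya_module A =
     \<lparr>smul = maya_smul,
      piece = (\<lambda>j. module.span maya_smul {maya_basis A j k | k. (j, k) \<in> maya_index A}),
      up = (\<lambda>j f. \<Sum>k=1..card A. maya_smul (f (j, k)) (maya_basis A (j + 1) (k + 1))),
      down = (\<lambda>j f. \<Sum>k=1..card A. maya_smul (f (j, k)) (maya_basis A (j - 1) k))\<rparr>"

end

theory Submission
  imports Defs
begin

text \<open>
  Choose a linear functional on \<open>M\<^sub>i\<close> that does not vanish on the socle. Composing it with the paths
  from \<open>j\<close> to \<open>i\<close> gives coordinates on \<open>M\<^sub>j\<close>: up to the relations, such a path is a shortest path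
  preceded by a power of the loop \<open>j \<rightarrow> j+1 \<rightarrow> j\<close>. The common kernel of the coordinates is a submodule
  meeting the socle trivially, hence zero, so \<open>M\<^sub>j\<close> becomes a space of sequences, on which the loop
  acts as the shift. A finite-dimensional shift-stable space of finitely supported sequences consists
  of all sequences supported on an initial segment, and its length is the dimension. In these
  coordinates the structure maps towards \<open>i\<close> are inclusions and those away from \<open>i\<close> are shifts, so
  the dimension vector determines \<open>M\<close>; the \<open>m\<close>-th coordinate in degree \<open>j\<close> is the coefficient of
  \<open>w\<^sub>j\<^sub>,\<^sub>k\<close> with \<open>k = min i j - m\<close>.
\<close>

section \<open>Modules and their socles\<close>

locale preproj =
  fixes n :: nat and M :: "('k::field, 'a::ab_group_add) graded_rep"
  assumes preproj: "preproj_module n M"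
begin

sublocale vector_space "smul M"
  using preproj by (simp add: preproj_module_def)

lemma subspace_piece: "subspace (piece M j)"
  using preproj by (simp add: preproj_module_def)

lemma piece_outside: "j \<notin> {1..n-1} \<Longrightarrow> piece M j = {0}"
  using preproj unfolding preproj_module_def by blast

lemma linear_up: "linear_between (smul M) (smul M) (piece M j) (piece M (Suc j)) (up M j)"
  using preproj by (simp add: preproj_module_def)

lemma linear_down:
  "linear_between (smul M) (smul M) (piece M (Suc j)) (piece M j) (down M (Suc j))"
  using preproj by (simp add: preproj_module_def)

lemma linear_between_zero:
  assumes "linear_between (smul M) s (piece M j) V g" "vector_space s"
  shows "g 0 = 0"
proof -
  interpret s: vector_space s by fact
  have "g (smul M 0 0) = s 0 (g 0)"
    using assms(1) subspace_0[OF subspace_piece[of j]] unfolding linear_between_def by blast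
  then show ?thesis by simp
qed

lemma up_closed: "x \<in> piece M j \<Longrightarrow> up M j x \<in> piece M (Suc j)"
  using linear_up[of j] by (simp add: linear_between_def)

lemma down_closed: "x \<in> piece M (Suc j) \<Longrightarrow> down M (Suc j) x \<in> piece M j"
  using linear_down[of j] by (simp add: linear_between_def)

lemma up_zero: "up M j 0 = 0"
  by (rule linear_between_zero[OF linear_up]) unfold_locales

lemma down_zero: "down M (Suc j) 0 = 0"
  by (rule linear_between_zero[OF linear_down]) unfold_locales

lemma down_up:
  assumes "x \<in> piece M (Suc j)"
  shows "down M (Suc (Suc j)) (up M (Suc j) x) = up M j (down M (Suc j) x)"
proof (cases "Suc j \<in> {1..n-1}")
  case True
  then show ?thesis using preproj assms unfolding preproj_module_def
    by (metis Suc_eq_plus1 diff_Suc_1)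
next
  case False
  then have "x = 0" using piece_outside assms by blast
  then show ?thesis by (simp add: up_zero down_zero)
qed

text \<open>On such a family \<open>up\<close> kills no nonzero vector: if \<open>up\<close> kills
  \<open>x\<close>, the relation shows that it also kills \<open>down x\<close>, which is zero by
  induction on the degree, so \<open>x\<close> lies in the socle. Pushing a vector up to degree
  \<open>n\<close>, where the piece is zero, then forces it to be zero. Closure under addition does
  not enter.\<close>

lemma socle_free_family_zero:
  assumes K: "\<And>j. K j \<subseteq> piece M j"
    and upK: "\<And>j x. x \<in> K j \<Longrightarrow> up M j x \<in> K (Suc j)"
    and downK: "\<And>j x. x \<in> K (Suc j) \<Longrightarrow> down M (Suc j) x \<in> K j"
    and no_socle: "\<And>j x. x \<in> K (Suc j) \<Longrightarrow> up M (Suc j) x = 0 \<Longrightarrow> down M (Suc j) x = 0 \<Longrightarrow> x = 0"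
    and "x \<in> K j"
  shows "x = 0"
proof -
  have up_ker: "x = 0" if "x \<in> K j" "up M j x = 0" for j x
    using that
  proof (induction j arbitrary: x)
    case 0
    then show ?case using K[of 0] piece_outside[of 0] by auto
  next
    case (Suc j)
    have "up M j (down M (Suc j) x) = 0"
      using down_up[of x j] K Suc.prems down_zero by (metis subsetD)
    then have "down M (Suc j) x = 0" using Suc downK by blast
    then show ?case using no_socle Suc.prems by blast
  qed
  show ?thesis
    using \<open>x \<in> K j\<close>
  proof (induction "n - j" arbitrary: j x)
    case 0
    then have "j \<notin> {1..n-1}" by auto
    then show ?case using K[of j] piece_outside[of j] 0 by blast
  next
    case (Suc d)
    then have "up M j x = 0" using upK[of x j] by (metis Suc_diff_Suc Suc_inject zero_less_Suc zero_less_diff)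
    then show ?case using up_ker Suc by blast
  qed
qed

section \<open>The loop at each degree: it commutes with the structure maps and is nilpotent\<close>

definition loop :: "nat \<Rightarrow> 'a \<Rightarrow> 'a" where
  "loop j x = down M (Suc j) (up M j x)"

lemma linear_loop: "linear_between (smul M) (smul M) (piece M j) (piece M j) (loop j)"
  using linear_up[of j] linear_down[of j] by (simp add: linear_between_def loop_def)

lemma linear_loop_power:
  "linear_between (smul M) (smul M) (piece M j) (piece M j) (loop j ^^ m)"
  using linear_loop[of j] by (induction m) (simp_all add: linear_between_def)

lemma loop_power_closed: "x \<in> piece M j \<Longrightarrow> (loop j ^^ m) x \<in> piece M j"
  using linear_loop_power[of j m] by (simp add: linear_between_def)

text \<open>Both sides run through \<open>up\<close>, \<open>down\<close>, \<open>up\<close> for a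
  single loop; the relation in degree \<open>Suc j\<close> identifies the two. With the analogue for
  \<open>down\<close>, the loops form an endomorphism of the module.\<close>

lemma up_loop_power: "up M j ((loop j ^^ m) x) = (loop (Suc j) ^^ m) (up M j x)"
  if "x \<in> piece M j"
proof (induction m)
  case (Suc m)
  have "down M (Suc (Suc j)) (up M (Suc j) (up M j ((loop j ^^ m) x))) = up M j (loop j ((loop j ^^ m) x))"
    using down_up[OF up_closed[OF loop_power_closed[OF that]]] by (simp add: loop_def)
  then show ?case using Suc by (simp add: loop_def)
qed simp

lemma down_loop_power:
  "down M (Suc j) ((loop (Suc j) ^^ m) x) = (loop j ^^ m) (down M (Suc j) x)"
  if "x \<in> piece M (Suc j)"
proof (induction m)
  case (Suc m)
  have "down M (Suc j) (loop (Suc j) ((loop (Suc j) ^^ m) x))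
      = loop j (down M (Suc j) ((loop (Suc j) ^^ m) x))"
    using down_up[OF loop_power_closed[OF that]] by (simp add: loop_def)
  then show ?case using Suc by simp
qed simp

lemma up_down_loop:
  assumes "x \<in> piece M (Suc j)"
  shows "up M j (down M (Suc j) x) = loop (Suc j) x"
  using down_up[OF assms] by (simp add: loop_def)

text \<open>By the relation one loop factors as \<open>down\<close> followed by \<open>up\<close>.
  The remaining loops commute past this \<open>up\<close>, so they act one degree lower, and after
  \<open>j\<close> rounds degree 0 is reached, where the piece is zero.\<close>

lemma loop_nilpotent:
  assumes "x \<in> piece M j" "j \<le> m"
  shows "(loop j ^^ m) x = 0"
  using assms
proof (induction j arbitrary: m x)
  case 0
  then show ?case using loop_power_closed[OF 0(1), of m] piece_outside[of 0] by simp
next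
  case (Suc j)
  then obtain p where p: "m = Suc p" "j \<le> p" by (cases m) auto
  have "(loop (Suc j) ^^ m) x = (loop (Suc j) ^^ p) (up M j (down M (Suc j) x))"
    by (simp only: p up_down_loop[OF Suc.prems(1)] funpow_Suc_right o_apply)
  also have "\<dots> = up M j ((loop j ^^ p) (down M (Suc j) x))"
    by (simp add: up_loop_power down_closed Suc.prems)
  also have "\<dots> = 0"
    using Suc p by (simp add: down_closed up_zero)
  finally show ?case .
qed

section \<open>Shortest paths between two degrees\<close>

primrec up_path :: "nat \<Rightarrow> nat \<Rightarrow> 'a \<Rightarrow> 'a" where
  "up_path 0 j x = x"
| "up_path (Suc d) j x = up_path d (Suc j) (up M j x)"

primrec down_path :: "nat \<Rightarrow> nat \<Rightarrow> 'a \<Rightarrow> 'a" where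
  "down_path 0 j x = x"
| "down_path (Suc d) j x = down_path d (j - 1) (down M j x)"

definition path :: "nat \<Rightarrow> nat \<Rightarrow> 'a \<Rightarrow> 'a" where
  "path i j x = (if j \<le> i then up_path (i - j) j x else down_path (j - i) j x)"

lemma path_self [simp]: "path i i x = x"
  by (simp add: path_def)

lemma path_up: "j < i \<Longrightarrow> path i (Suc j) (up M j x) = path i j x"
  by (simp add: path_def Suc_diff_Suc[symmetric])

lemma path_down: "i \<le> j \<Longrightarrow> path i j (down M (Suc j) x) = path i (Suc j) x"
  by (auto simp add: path_def Suc_diff_le)

lemma linear_up_path:
  "linear_between (smul M) (smul M) (piece M j) (piece M (j + d)) (up_path d j)"
proof (induction d arbitrary: j)
  case (Suc d)
  then show ?case using Suc[of "Suc j"] linear_up[of j] by (simp add: linear_between_def)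
qed (simp add: linear_between_def)

lemma linear_down_path:
  "linear_between (smul M) (smul M) (piece M (j + d)) (piece M j) (down_path d (j + d))"
proof (induction d)
  case (Suc d)
  then show ?case using linear_down[of "j + d"] by (simp add: linear_between_def)
qed (simp add: linear_between_def)

lemma linear_path: "linear_between (smul M) (smul M) (piece M j) (piece M i) (path i j)"
  using linear_up_path[of j "i - j"] linear_down_path[of i "j - i"]
  by (auto simp: path_def linear_between_def)

text \<open>Passes from the socle as largest semisimple submodule to its description by elements: a
  nonzero vector killed by both maps spans a simple submodule concentrated in one degree, and
  maximality puts it into \<open>U\<close>.\<close>

lemma socle_element_mem:
  assumes "is_socle U M" "w \<in> piece M j" "up M j w = 0" "1 \<le> j" "down M j w = 0"
  shows "w \<in> U j"
proof -
  define V where "V l = (if l = j then span {w} else {0})" for l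
  obtain p where p: "j = Suc p" using assms by (cases j) auto
  have VM: "V l \<subseteq> piece M l" for l
    using assms span_minimal[of "{w}" "piece M j"] subspace_piece subspace_0[OF subspace_piece]
    by (auto simp: V_def)
  have upV: "up M l x = 0" if "x \<in> V l" for l x
    using that linear_up[of l] assms
    by (auto simp: V_def up_zero span_singleton linear_between_def split: if_splits)
  have downV: "down M (Suc l) x = 0" if "x \<in> V (Suc l)" for l x
    using that linear_down[of l] assms p
    by (auto simp: V_def down_zero span_singleton linear_between_def split: if_splits)
  have subV: "subspace (V l)" for l by (simp add: V_def)
  have submV: "submodule V M"
    unfolding submodule_def using VM upV downV subV by (auto intro: subspace_0)
  have sing: "W = {0} \<or> W = span {w}" if W: "subspace W" "W \<subseteq> span {w}" for W
  proof (cases "W = {0}")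
    case False
    then obtain x where x: "x \<in> W" "x \<noteq> 0" using subspace_0[OF W(1)] by auto
    then obtain k where k: "x = smul M k w" using W(2) by (auto simp: span_singleton)
    then have "k \<noteq> 0" using x by auto
    then have "w = smul M (inverse k) x" by (simp add: k)
    then have "w \<in> W" using x W subspace_scale by metis
    then show ?thesis using W span_minimal[of "{w}" W] by blast
  qed simp
  have "w \<in> U j" if "w \<noteq> 0"
  proof -
    have simpV: "simple_module (restrict_to M V)"
      unfolding simple_module_def
    proof (intro conjI allI impI)
      show "\<exists>l. piece (restrict_to M V) l \<noteq> {0}"
        using that span_base[of w "{w}"] by (auto simp: restrict_to_def V_def intro!: exI[of _ j])
      fix W assume "submodule W (restrict_to M V)"
      then have W: "subspace (W l)" "W l \<subseteq> V l" for l
        by (auto simp: submodule_def restrict_to_def)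
      have z: "W l = {0}" if "l \<noteq> j" for l
        using W[of l] subspace_0[OF W(1)] that by (auto simp: V_def)
      have "W = V" if "W j = V j"
        using that z by (auto simp: V_def fun_eq_iff)
      moreover have "W l = {0}" if "W j = {0}" for l
        using that z by (cases "l = j") auto
      moreover have "W j = {0} \<or> W j = V j" using sing[of "W j"] W[of j] by (simp add: V_def)
      ultimately show "(\<forall>l. W l = {0}) \<or> W = piece (restrict_to M V)"
        by (auto simp: restrict_to_def)
    qed
    have "semisimple_module (restrict_to M V)"
      unfolding semisimple_module_def
    proof
      fix l
      let ?T = "\<Union>{W l |W. submodule W (restrict_to M V) \<and> simple_module (restrict_to (restrict_to M V) W)}"
      \<comment> \<open>\<open>V\<close> occurs among its own simple submodules, so the union is
        exactly \<open>V l\<close>, a subspace equal to its span.\<close>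
      have "submodule V (restrict_to M V)"
        using submV by (simp add: submodule_def restrict_to_def)
      then have "V l \<subseteq> ?T" using simpV by (auto simp: restrict_to_def)
      moreover have "?T \<subseteq> V l" by (auto simp: submodule_def restrict_to_def)
      ultimately have "?T = V l" by blast
      then show "piece (restrict_to M V) l = module.span (smul (restrict_to M V)) ?T"
        by (simp add: restrict_to_def span_eq_iff[THEN iffD2, OF subV])
    qed
    then have "V j \<subseteq> U j" using assms(1) submV unfolding is_socle_def by blast
    then show ?thesis using span_base[of w "{w}"] by (auto simp: V_def)
  qed
  moreover have "0 \<in> U j"
    using assms(1) subspace_0 by (simp add: is_socle_def submodule_def)
  ultimately show ?thesis by blast
qed

end

section \<open>Coordinates from a functional on the socle\<close>

text \<open>\<open>socle_detected\<close> says that the socle is concentrated in degree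
  \<open>i\<close> and that \<open>f\<close> has trivial kernel on it. This is all that the
  coordinates need to know about the socle.\<close>

locale preproj_functional = preproj n M
  for n :: nat and M :: "('k::field, 'a::ab_group_add) graded_rep" +
  fixes i :: nat and f :: "'a \<Rightarrow> 'k"
  assumes linear_functional: "linear_between (smul M) (*) (piece M i) UNIV f"
    and socle_detected: "\<lbrakk>x \<in> piece M (Suc j); up M (Suc j) x = 0; down M (Suc j) x = 0;
      Suc j = i \<Longrightarrow> f x = 0\<rbrakk> \<Longrightarrow> x = 0"
begin

definition coord :: "nat \<Rightarrow> 'a \<Rightarrow> nat \<Rightarrow> 'k" where
  "coord j x m = f (path i j ((loop j ^^ m) x))"

lemma linear_coord: "linear_between (smul M) (*) (piece M j) UNIV (\<lambda>x. coord j x m)"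
  using linear_functional linear_path[of j i] linear_loop_power[of j m]
  by (simp add: coord_def linear_between_def)

lemma coord_add:
  "x \<in> piece M j \<Longrightarrow> y \<in> piece M j \<Longrightarrow> coord j (x + y) m = coord j x m + coord j y m"
  using linear_coord[of j m] by (simp add: linear_between_def)

lemma coord_smul: "x \<in> piece M j \<Longrightarrow> coord j (smul M c x) m = c * coord j x m"
  using linear_coord[of j m] by (simp add: linear_between_def)

lemma coord_zero [simp]: "coord j 0 m = 0"
  using coord_smul[OF subspace_0[OF subspace_piece], of j 0 m] by simp

lemma coord_sum:
  assumes "\<And>q. q \<in> Q \<Longrightarrow> x q \<in> piece M j"
  shows "coord j (\<Sum>q\<in>Q. smul M (c q) (x q)) m = (\<Sum>q\<in>Q. c q * coord j (x q) m)"
  using assms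
proof (induction Q rule: infinite_finite_induct)
  case (insert q Q)
  then show ?case
    using subspace_sum[OF subspace_piece[of j], of Q "\<lambda>q. smul M (c q) (x q)"]
    by (simp add: coord_add coord_smul subspace_scale[OF subspace_piece])
qed simp_all

lemma coord_loop_power: "coord j ((loop j ^^ q) x) m = coord j x (m + q)"
  by (simp add: coord_def funpow_add)

text \<open>A step towards \<open>i\<close> is absorbed by the shortest path and leaves the
  coordinates unchanged; a step away from \<open>i\<close> has to be undone, which costs one loop
  and shifts them by one. The next three lemmas are the other cases of this.\<close>

lemma coord_up_below: "x \<in> piece M j \<Longrightarrow> j < i \<Longrightarrow> coord (Suc j) (up M j x) m = coord j x m"
  by (simp add: coord_def up_loop_power[symmetric] path_up)

lemma coord_up_above:
  "x \<in> piece M j \<Longrightarrow> i \<le> j \<Longrightarrow> coord (Suc j) (up M j x) m = coord j x (Suc m)"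
  by (simp add: coord_def up_loop_power[symmetric] path_down[symmetric] loop_def)

lemma coord_down_below:
  "x \<in> piece M (Suc j) \<Longrightarrow> j < i \<Longrightarrow> coord j (down M (Suc j) x) m = coord (Suc j) x (Suc m)"
  by (simp add: coord_def down_loop_power[symmetric] path_up[symmetric] up_down_loop
      loop_power_closed)

lemma coord_down_above:
  "x \<in> piece M (Suc j) \<Longrightarrow> i \<le> j \<Longrightarrow> coord j (down M (Suc j) x) m = coord (Suc j) x m"
  by (simp add: coord_def down_loop_power[symmetric] path_down)

text \<open>The common kernel \<open>K\<close> of the coordinates is stable under both maps, since
  these copy or shift the coordinates, and it contains no nonzero socle vector, so
  \<open>socle_free_family_zero\<close> applies.\<close>

lemma coord_eq_zero_iff:
  assumes "x \<in> piece M j"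
  shows "(\<forall>m. coord j x m = 0) \<longleftrightarrow> x = 0"
proof
  define K where "K j = {x \<in> piece M j. \<forall>m. coord j x m = 0}" for j
  assume "\<forall>m. coord j x m = 0"
  then have "x \<in> K j" using assms by (simp add: K_def)
  then show "x = 0"
  proof (rule socle_free_family_zero[rotated -1])
    show "up M j x \<in> K (Suc j)" if "x \<in> K j" for j x
      using that up_closed coord_up_below coord_up_above by (cases "j < i") (auto simp: K_def)
    show "down M (Suc j) x \<in> K j" if "x \<in> K (Suc j)" for j x
      using that down_closed coord_down_below coord_down_above
      by (cases "j < i") (auto simp: K_def)
    show "x = 0" if "x \<in> K (Suc j)" "up M (Suc j) x = 0" "down M (Suc j) x = 0" for j x
    proof (rule socle_detected)
      assume "Suc j = i"
      \<comment> \<open>In degree \<open>i\<close> the coordinate with index 0 is \<open>f\<close>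
        itself, as both the path and the loop power are trivial.\<close>
      have "coord (Suc j) x 0 = 0" using that(1) by (simp add: K_def)
      then show "f x = 0" by (simp add: coord_def \<open>Suc j = i\<close>)
    qed (use that in \<open>auto simp: K_def\<close>)
  qed (auto simp: K_def)
qed simp

lemma coord_inject:
  assumes "x \<in> piece M j" "y \<in> piece M j" "\<And>m. coord j x m = coord j y m"
  shows "x = y"
proof -
  have "coord j (x + smul M (-1) y) m = 0" for m
    using assms
    by (simp add: coord_add coord_smul subspace_scale[OF subspace_piece] del: scale_minus_left)
  then have "x + smul M (-1) y = 0"
    using assms coord_eq_zero_iff subspace_add[OF subspace_piece] subspace_scale[OF subspace_piece]
    by metis
  then show ?thesis by simp
qed

text \<open>Triangular elimination: the loop powers of \<open>y\<close> have their last nonzero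
  coordinate at \<open>d\<close>, \<open>d - 1\<close>, ..., 0, so any sequence supported on these
  indices can be cleared from the top down.\<close>

lemma coord_prefix_surj:
  assumes "y \<in> piece M j" "coord j y d \<noteq> 0" "\<And>m. d < m \<Longrightarrow> coord j y m = 0"
    and "q \<le> Suc d" "\<And>m. q \<le> m \<Longrightarrow> s m = 0"
  shows "\<exists>x\<in>piece M j. coord j x = s"
  using assms(4,5)
proof (induction q arbitrary: s)
  case 0
  then show ?case using subspace_0[OF subspace_piece] by (intro bexI[of _ 0]) auto
next
  case (Suc q)
  \<comment> \<open>Shifting by \<open>d - q\<close> moves the last nonzero coordinate of
    \<open>y\<close> from \<open>d\<close> to \<open>q\<close>; the scalar \<open>c\<close> below is
    chosen to cancel \<open>s q\<close>.\<close>
  define z where "z = (loop j ^^ (d - q)) y"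
  have z: "z \<in> piece M j" by (simp add: z_def loop_power_closed assms)
  have top: "coord j z q \<noteq> 0" "\<And>m. q < m \<Longrightarrow> coord j z m = 0"
    using assms Suc.prems(1) by (simp_all add: z_def coord_loop_power)
  define c where "c = s q / coord j z q"
  have "s m - c * coord j z m = 0" if "q \<le> m" for m
    using that top Suc.prems(2) by (cases "m = q") (simp_all add: c_def)
  with Suc.IH[of "\<lambda>m. s m - c * coord j z m"] Suc.prems(1)
  obtain x where x: "x \<in> piece M j" "coord j x = (\<lambda>m. s m - c * coord j z m)" by auto
  have "coord j (x + smul M c z) = s"
    using x z by (auto simp: coord_add coord_smul subspace_scale[OF subspace_piece])
  moreover have "x + smul M c z \<in> piece M j"
    using x z subspace_add[OF subspace_piece] subspace_scale[OF subspace_piece] by blast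
  ultimately show ?case by blast
qed

text \<open>Preimages of the unit sequences form a basis: the coordinates read off the coefficients
  of a combination, which gives independence, and \<open>coord_inject\<close> gives
  spanning.\<close>

lemma dim_piece_if_coord_range:
  assumes vanish: "\<And>x m. x \<in> piece M j \<Longrightarrow> d \<le> m \<Longrightarrow> coord j x m = 0"
    and surj: "\<And>s. (\<And>m. d \<le> m \<Longrightarrow> s m = 0) \<Longrightarrow> \<exists>x\<in>piece M j. coord j x = s"
  shows "dim_vector M j = d"
proof -
  have "\<exists>x\<in>piece M j. coord j x = (\<lambda>m. if m = q then 1 else 0)" if "q < d" for q
    using that by (intro surj) auto
  then obtain b where b: "\<And>q. q < d \<Longrightarrow> b q \<in> piece M j"
    "\<And>q. q < d \<Longrightarrow> coord j (b q) = (\<lambda>m. if m = q then 1 else 0)"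
    by metis
  have inj: "inj_on b {..<d}"
  proof (rule inj_onI)
    fix p q assume "p \<in> {..<d}" "q \<in> {..<d}" "b p = b q"
    then have "coord j (b q) p = 1" "q < d" using b(2)[of p] by auto
    then show "p = q" using b(2)[of q] by (auto split: if_splits)
  qed
  have coord_comb: "coord j (\<Sum>q<d. smul M (c q) (b q)) m = (if m < d then c m else 0)" for c m
  proof -
    have "coord j (\<Sum>q<d. smul M (c q) (b q)) m = (\<Sum>q<d. c q * coord j (b q) m)"
      using b by (intro coord_sum) auto
    also have "\<dots> = (\<Sum>q<d. if q = m then c q else 0)"
      using b by (intro sum.cong) auto
    finally show ?thesis by simp
  qed
  have "independent (b ` {..<d})"
  proof
    assume "dependent (b ` {..<d})"
    then obtain u q where u: "(\<Sum>v\<in>b ` {..<d}. smul M (u v) v) = 0" "q < d" "u (b q) \<noteq> 0"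
      by (auto simp: dependent_finite)
    then have "(\<Sum>q<d. smul M (u (b q)) (b q)) = 0"
      by (simp add: sum.reindex[OF inj])
    with coord_comb[of "\<lambda>q. u (b q)" q] u show False by simp
  qed
  moreover have "span (b ` {..<d}) = piece M j"
  proof
    show "span (b ` {..<d}) \<subseteq> piece M j"
      using b by (intro span_minimal subspace_piece) auto
    show "piece M j \<subseteq> span (b ` {..<d})"
    proof
      fix x assume x: "x \<in> piece M j"
      let ?y = "\<Sum>q<d. smul M (coord j x q) (b q)"
      have "x = ?y"
      proof (rule coord_inject[OF x])
        show "?y \<in> piece M j"
          using b by (intro subspace_sum[OF subspace_piece] subspace_scale[OF subspace_piece]) auto
        show "coord j x m = coord j ?y m" for m
          using vanish[OF x, of m] by (simp add: coord_comb)
      qed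
      then show "x \<in> span (b ` {..<d})"
        by (metis (no_types, lifting) span_sum span_scale span_base imageI)
    qed
  qed
  ultimately have "dim (piece M j) = card (b ` {..<d})"
    by (metis dim_eq_card span_span)
  then show ?thesis by (simp add: dim_vector_def card_image[OF inj])
qed

text \<open>Let \<open>D\<close> collect the indices at which some vector has a nonzero coordinate.
  Nilpotency bounds \<open>D\<close>, so a vector with a nonzero coordinate at \<open>Max D\<close>
  satisfies \<open>coord_prefix_surj\<close>, and every sequence of length
  \<open>Suc (Max D)\<close> occurs. This length is the dimension.\<close>

lemma coord_image:
  "coord j ` piece M j = {s. \<forall>m\<ge>dim_vector M j. s m = 0}"
proof -
  have "\<exists>d. (\<forall>x\<in>piece M j. \<forall>m\<ge>d. coord j x m = 0) \<and>
      (\<forall>s. (\<forall>m\<ge>d. s m = 0) \<longrightarrow> (\<exists>x\<in>piece M j. coord j x = s))"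
  \<comment> \<open>For the zero piece \<open>D\<close> would be empty and \<open>Max D\<close>
    meaningless.\<close>
  proof (cases "piece M j = {0}")
    case True
    then show ?thesis by (intro exI[of _ 0]) auto
  next
    case False
    define D where "D = {m. \<exists>x\<in>piece M j. coord j x m \<noteq> 0}"
    have "m < j" if "m \<in> D" for m
    proof (rule ccontr)
      assume "\<not> m < j"
      then have "coord j x m = 0" if "x \<in> piece M j" for x
        using coord_loop_power[of j m x 0] loop_nilpotent[OF that, of m] by simp
      then show False using \<open>m \<in> D\<close> by (auto simp: D_def)
    qed
    then have "finite D" by (meson finite_nat_set_iff_bounded)
    obtain x where "x \<in> piece M j" "x \<noteq> 0"
      using False subspace_0[OF subspace_piece] by blast
    then have "D \<noteq> {}" using coord_eq_zero_iff unfolding D_def by blast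
    then have "Max D \<in> D" using \<open>finite D\<close> by simp
    then obtain y where y: "y \<in> piece M j" "coord j y (Max D) \<noteq> 0" by (auto simp: D_def)
    have vanish: "coord j x m = 0" if "x \<in> piece M j" "Max D < m" for x m
      using that Max_ge[OF \<open>finite D\<close>, of m] by (auto simp: D_def)
    show ?thesis
    proof (intro exI[of _ "Suc (Max D)"] conjI ballI allI impI)
      show "coord j x m = 0" if "x \<in> piece M j" "Suc (Max D) \<le> m" for x m
        using that vanish by simp
      show "\<exists>x\<in>piece M j. coord j x = s" if "\<forall>m\<ge>Suc (Max D). s m = 0" for s
        using that vanish y by (intro coord_prefix_surj[of y j "Max D" "Suc (Max D)"]) auto
    qed
  qed
  then obtain d where d: "\<And>x m. x \<in> piece M j \<Longrightarrow> d \<le> m \<Longrightarrow> coord j x m = 0"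
    "\<And>s. (\<And>m. d \<le> m \<Longrightarrow> s m = 0) \<Longrightarrow> \<exists>x\<in>piece M j. coord j x = s"
    by blast
  have "dim_vector M j = d"
    using d by (rule dim_piece_if_coord_range)
  then show ?thesis using d by (auto simp: image_iff) metis
qed

lemma coord_vanish: "x \<in> piece M j \<Longrightarrow> dim_vector M j \<le> m \<Longrightarrow> coord j x m = 0"
  using coord_image[of j] by blast

lemma dim_outside: "j \<notin> {1..n-1} \<Longrightarrow> dim_vector M j = 0"
  using piece_outside[of j] dim_span[of "{}"] dim_eq_card_independent[OF independent_empty]
  by (simp add: dim_vector_def)

end

section \<open>Comparison with the Maya module\<close>

lemma kth_element_le_iff:
  assumes "finite A" "1 \<le> k" "k \<le> card A"
  shows "kth_element A k \<le> j \<longleftrightarrow> k \<le> card {a \<in> A. a \<le> j}"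
proof -
  define xs where "xs = sorted_list_of_set A"
  have xs: "sorted xs" "distinct xs" "set xs = A" "length xs = card A"
    using assms by (auto simp: xs_def)
  show ?thesis
  proof
    assume le: "kth_element A k \<le> j"
    have "xs ! l \<le> j" if "l < k" for l
    proof -
      have "l \<le> k - 1" "k - 1 < length xs" using that assms xs by auto
      then have "xs ! l \<le> xs ! (k - 1)" by (rule sorted_nth_mono[OF xs(1)])
      then show ?thesis using le by (simp add: kth_element_def xs_def[symmetric])
    qed
    then have "set (take k xs) \<subseteq> {a \<in> A. a \<le> j}"
      using set_take_subset[of k xs] by (auto simp: in_set_conv_nth xs(3)[symmetric])
    then have "card (set (take k xs)) \<le> card {a \<in> A. a \<le> j}"
      using assms by (intro card_mono) auto
    then show "k \<le> card {a \<in> A. a \<le> j}"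
      using xs assms by (simp add: distinct_card)
  next
    assume k: "k \<le> card {a \<in> A. a \<le> j}"
    show "kth_element A k \<le> j"
    proof (rule ccontr)
      \<comment> \<open>The list is sorted, so if its \<open>k\<close>-th entry exceeds
        \<open>j\<close>, then all elements up to \<open>j\<close> are among the first
        \<open>k - 1\<close> entries.\<close>
      assume gt: "\<not> kth_element A k \<le> j"
      have "{a \<in> A. a \<le> j} \<subseteq> set (take (k - 1) xs)"
      proof
        fix a assume "a \<in> {a \<in> A. a \<le> j}"
        then obtain l where l: "l < length xs" "a = xs ! l" "xs ! l \<le> j"
          using xs(3) by (auto simp: in_set_conv_nth)
        then have "l < k - 1"
          using gt sorted_nth_mono[OF xs(1), of "k - 1" l]
          by (force simp: kth_element_def xs_def[symmetric])
        then show "a \<in> set (take (k - 1) xs)"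
          using l by (auto simp: in_set_conv_nth)
      qed
      then have "card {a \<in> A. a \<le> j} \<le> card (set (take (k - 1) xs))"
        by (intro card_mono) auto
      also have "\<dots> \<le> k - 1"
        by (rule order.trans[OF card_length]) simp
      finally show False using k assms by simp
    qed
  qed
qed

lemma maya_index_iff:
  assumes "finite A" "1 \<le> j" "1 \<le> k"
  shows "(j, k) \<in> maya_index A \<longleftrightarrow> k \<le> min (card A) j \<and> card {a \<in> A. a \<le> j} < k"
proof -
  \<comment> \<open>The subtraction is truncated; \<open>1 \<le> j\<close> excludes the spurious
    case in which both \<open>j\<close> and the element are 0.\<close>
  have "j \<le> kth_element A k - 1 \<longleftrightarrow> \<not> kth_element A k \<le> j"
    using assms(2) by auto
  then show ?thesis
    using assms kth_element_le_iff[OF assms(1,3), of j] by (auto simp: maya_index_def)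
qed

lemma root_combination_eq:
  assumes "1 \<le> m" "m \<le> n - 1"
  shows "root_combination n v m = int (v m) - (if m = 1 then 0 else int (v (m - 1)))"
proof -
  have "root_combination n v m
      = (\<Sum>j=1..n-1. (if j = m then int (v j) else 0) - (if j = m - 1 then int (v j) else 0))"
    unfolding root_combination_def simple_root_def
    using assms by (intro sum.cong) (auto simp: indicator_def)
  also have "\<dots> = int (v m) - (if m = 1 then 0 else int (v (m - 1)))"
    using assms by (auto simp: sum_subtractf)
  finally show ?thesis .
qed

text \<open>The entry of the root combination at \<open>m\<close> is \<open>v m - v (m - 1)\<close>,
  so summing the first \<open>j\<close> entries telescopes to \<open>v j\<close> on one side and
  counts the elements up to \<open>j\<close> of \<open>{1..i}\<close> and of \<open>A\<close> on the
  other.\<close>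

lemma dim_from_root_combination:
  assumes root: "root_combination n v = indicator {1..i} - indicator A"
    and A: "A \<subseteq> {1..n}" and "1 \<le> j" "j \<le> n - 1"
  shows "int (v j) = int (min i j) - int (card {a \<in> A. a \<le> j})"
  using assms(3,4)
proof (induction j rule: nat_induct_at_least)
  case base
  have "a \<in> A \<and> a \<le> 1 \<longleftrightarrow> 1 \<in> A \<and> a = 1" for a
    using subsetD[OF A, of a] by (auto simp: le_Suc_eq)
  then have "{a \<in> A. a \<le> 1} = (if 1 \<in> A then {1} else {})" by auto
  then have card: "card {a \<in> A. a \<le> 1} = (if 1 \<in> A then 1 else 0)" by simp
  have "int (v 1) = (if 1 \<le> i then 1 else 0) - (if 1 \<in> A then 1 else 0)"
    using root_combination_eq[of 1 n v] base unfolding root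
    by (cases "1 \<le> i"; cases "1 \<in> A") (simp_all add: indicator_def)
  then show ?case unfolding card by simp
next
  case (Suc j)
  have "{a \<in> A. a \<le> Suc j} = (if Suc j \<in> A then insert (Suc j) {a \<in> A. a \<le> j} else {a \<in> A. a \<le> j})"
    by (auto simp: le_Suc_eq)
  then have card: "card {a \<in> A. a \<le> Suc j} = card {a \<in> A. a \<le> j} + (if Suc j \<in> A then 1 else 0)"
    by simp
  have "int (v (Suc j)) - int (v j) = (if Suc j \<le> i then 1 else 0) - (if Suc j \<in> A then 1 else 0)"
    using root_combination_eq[of "Suc j" n v] Suc.hyps Suc.prems unfolding root
    by (cases "Suc j \<le> i"; cases "Suc j \<in> A") (simp_all add: indicator_def)
  moreover have "int (v j) = int (min i j) - int (card {a \<in> A. a \<le> j})"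
    using Suc by simp
  ultimately show ?case unfolding card
    by (cases "Suc j \<le> i"; cases "Suc j \<in> A") (simp_all add: min_def split: if_splits)
qed

section \<open>The Maya module as functions with prescribed support\<close>

lemma sum_fun_apply: "(\<Sum>x\<in>S. g x) p = (\<Sum>x\<in>S. g x p)"
  by (induction S rule: infinite_finite_induct) auto

lemma vector_space_maya_smul: "vector_space maya_smul"
  by unfold_locales (auto simp: maya_smul_def fun_eq_iff algebra_simps)

lemma finite_maya_index_row: "finite {k. (j, k) \<in> maya_index A}"
  by (rule finite_subset[of _ "{..card A}"]) (auto simp: maya_index_def)

lemma piece_maya_module:
  "piece (maya_module A :: ('k::field, nat \<times> nat \<Rightarrow> 'k) graded_rep) j =
     {f. \<forall>p. f p \<noteq> 0 \<longrightarrow> fst p = j \<and> p \<in> maya_index A}" (is "_ = ?R")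
proof -
  interpret vector_space "maya_smul :: 'k \<Rightarrow> (nat \<times> nat \<Rightarrow> 'k) \<Rightarrow> nat \<times> nat \<Rightarrow> 'k"
    by (rule vector_space_maya_smul)
  let ?B = "{maya_basis A j k | k. (j, k) \<in> maya_index A}"
  have "span ?B = ?R"
  proof
    have "subspace ?R"
      by (rule subspaceI) (auto simp: maya_smul_def, metis add.right_neutral, metis add.right_neutral)
    then show "span ?B \<subseteq> ?R"
      by (intro span_minimal) (auto simp: maya_basis_def indicator_def split: if_splits)
    show "?R \<subseteq> span ?B"
    proof
      fix f assume f: "f \<in> ?R"
      have "f = (\<Sum>k | (j, k) \<in> maya_index A. maya_smul (f (j, k)) (maya_basis A j k))" (is "_ = ?S")
      proof
        fix p :: "nat \<times> nat"
        have "?S p = (\<Sum>k | (j, k) \<in> maya_index A. if k = snd p then (if fst p = j then f (j, k) else 0) else 0)"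
          unfolding sum_fun_apply
          by (intro sum.cong) (auto simp: maya_smul_def maya_basis_def indicator_def prod_eq_iff)
        also have "\<dots> = f p"
          using f finite_maya_index_row[of j A] by (cases p) auto
        finally show "f p = ?S p" by simp
      qed
      also have "\<dots> \<in> span ?B"
        by (intro span_sum span_scale span_base) auto
      finally show "f \<in> span ?B" .
    qed
  qed
  then show ?thesis by (simp add: maya_module_def)
qed

lemma maya_up_apply:
  "up (maya_module A) j f (l, k) =
    (if l = Suc j \<and> 2 \<le> k \<and> (l, k) \<in> maya_index A then f (j, k - 1) else 0)"
proof -
  have "up (maya_module A) j f (l, k) =
      (\<Sum>q=1..card A. if q = k - 1 then (if l = Suc j \<and> 2 \<le> k \<and> (l, k) \<in> maya_index A then f (j, q) else 0) else 0)"
    unfolding maya_module_def graded_rep.simps sum_fun_apply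
    by (intro sum.cong) (auto simp: maya_smul_def maya_basis_def indicator_def)
  also have "\<dots> = (if l = Suc j \<and> 2 \<le> k \<and> (l, k) \<in> maya_index A then f (j, k - 1) else 0)"
    by (auto simp: maya_index_def)
  finally show ?thesis .
qed

lemma maya_down_apply:
  "down (maya_module A) (Suc j) f (l, k) =
    (if l = j \<and> (l, k) \<in> maya_index A then f (Suc j, k) else 0)"
proof -
  have "down (maya_module A) (Suc j) f (l, k) =
      (\<Sum>q=1..card A. if q = k then (if l = j \<and> (l, k) \<in> maya_index A then f (Suc j, q) else 0) else 0)"
    unfolding maya_module_def graded_rep.simps sum_fun_apply
    by (intro sum.cong) (auto simp: maya_smul_def maya_basis_def indicator_def)
  also have "\<dots> = (if l = j \<and> (l, k) \<in> maya_index A then f (Suc j, k) else 0)"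
    by (auto simp: maya_index_def)
  finally show ?thesis .
qed

section \<open>The isomorphism onto the Maya module\<close>

locale preproj_maya = preproj_functional n M i f
  for n :: nat and M :: "('k::field, 'a::ab_group_add) graded_rep" and i f +
  fixes A :: "nat set"
  assumes A_subset: "A \<subseteq> {1..n}" and card_A: "card A = i"
    and root: "root_combination n (dim_vector M) = indicator {1..i} - indicator A"
begin

lemma finite_A: "finite A"
  using A_subset finite_subset by blast

text \<open>Row \<open>j\<close> of the index set consists of the \<open>k\<close> up to
  \<open>min i j\<close> that exceed the number of elements of \<open>A\<close> up to
  \<open>j\<close>, and that number is \<open>min i j\<close> minus the dimension. In degrees from
  \<open>n\<close> on all of \<open>A\<close> is counted, so the row is empty and the piece is
  zero.\<close>

lemma mem_index_iff:
  assumes "1 \<le> k" "k \<le> min i j"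
  shows "(j, k) \<in> maya_index A \<longleftrightarrow> min i j - k < dim_vector M j"
proof (cases "j \<le> n - 1")
  case True
  then show ?thesis
    using assms dim_from_root_combination[OF root A_subset, of j]
    by (auto simp: maya_index_iff finite_A card_A)
next
  case False
  then have "n \<le> j" by simp
  then have "{a \<in> A. a \<le> j} = A" using A_subset by force
  then show ?thesis
    using assms False by (auto simp: maya_index_iff finite_A card_A dim_outside)
qed

lemma index_bounds: "(j, k) \<in> maya_index A \<Longrightarrow> 1 \<le> k \<and> k \<le> min i j"
  by (auto simp: maya_index_def card_A)

lemma dim_le: "dim_vector M j \<le> min i j"
proof (cases "j \<in> {1..n-1}")
  case True
  then show ?thesis using dim_from_root_combination[OF root A_subset, of j] by auto
qed (simp add: dim_outside)

text \<open>The reversal \<open>m = min i j - k\<close> matches both rules. Under \<open>up\<close>,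
  \<open>k\<close> grows by one, and so does \<open>min i j\<close> exactly when
  \<open>j < i\<close>: then \<open>m\<close> is kept, otherwise it drops by one. Under
  \<open>down\<close>, \<open>k\<close> is fixed and \<open>m\<close> changes only with
  \<open>min i j\<close>. The bounds on \<open>k\<close> guard the truncated subtraction.\<close>

definition to_maya :: "nat \<Rightarrow> 'a \<Rightarrow> nat \<times> nat \<Rightarrow> 'k" where
  "to_maya j x = (\<lambda>(l, k). if l = j \<and> 1 \<le> k \<and> k \<le> min i j then coord j x (min i j - k) else 0)"

lemma to_maya_mem:
  assumes "x \<in> piece M j"
  shows "to_maya j x \<in> piece (maya_module A) j"
proof -
  have "(j, k) \<in> maya_index A"
    if "1 \<le> k" "k \<le> min i j" "coord j x (min i j - k) \<noteq> 0" for k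
    using that coord_vanish[OF assms] mem_index_iff by (meson not_le)
  then show ?thesis by (auto simp: piece_maya_module to_maya_def split: if_splits)
qed

lemma to_maya_apply:
  assumes "x \<in> piece M j"
  shows "to_maya j x (l, k) = (if l = j \<and> (l, k) \<in> maya_index A then coord j x (min i j - k) else 0)"
proof (cases "(l, k) \<in> maya_index A")
  case True
  then show ?thesis using index_bounds by (auto simp: to_maya_def)
next
  case False
  then show ?thesis using to_maya_mem[OF assms] by (auto simp: piece_maya_module)
qed

lemma module_hom_to_maya: "module_hom M (maya_module A) to_maya"
  unfolding module_hom_def
proof (intro conjI allI ballI)
  fix j
  show "linear_between (smul M) (smul (maya_module A)) (piece M j) (piece (maya_module A) j) (to_maya j)"
    unfolding linear_between_def
    by (simp add: to_maya_mem)
      (auto simp: to_maya_def coord_add coord_smul maya_module_def maya_smul_def fun_eq_iff)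
next
  fix j x assume x: "x \<in> piece M j"
  have "to_maya (Suc j) (up M j x) (l, k) = up (maya_module A) j (to_maya j x) (l, k)" for l k
  proof (cases "l = Suc j \<and> (l, k) \<in> maya_index A")
    case True
    have k: "1 \<le> k" "k \<le> min i (Suc j)" using True index_bounds by blast+
    have c: "coord (Suc j) (up M j x) (min i (Suc j) - k) = coord j x (Suc (min i j) - k)"
    proof (cases "j < i")
      case True
      then show ?thesis by (simp add: coord_up_below[OF x])
    next
      case False
      then show ?thesis using k by (simp add: coord_up_above[OF x] Suc_diff_le)
    qed
    have "Suc (min i j) - k = min i j - (k - 1)" using k by simp
    \<comment> \<open>This settles \<open>k = 1\<close>: there is no \<open>w\<close> with second
      index 0 to map to column 1, and the matching coordinate of \<open>x\<close> lies beyond the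
      dimension.\<close>
    moreover have "coord j x (min i j) = 0" using coord_vanish[OF x dim_le] .
    ultimately show ?thesis
      using True c k
      by (cases "k = 1") (auto simp: to_maya_apply[OF up_closed[OF x]] maya_up_apply to_maya_def)
  qed (auto simp: to_maya_apply[OF up_closed[OF x]] maya_up_apply)
  then show "to_maya (j + 1) (up M j x) = up (maya_module A) j (to_maya j x)"
    by (auto simp: fun_eq_iff)
next
  fix j x assume "x \<in> piece M (j + 1)"
  then have x: "x \<in> piece M (Suc j)" by simp
  have "to_maya j (down M (Suc j) x) (l, k) = down (maya_module A) (Suc j) (to_maya (Suc j) x) (l, k)" for l k
  proof (cases "l = j \<and> (l, k) \<in> maya_index A")
    case True
    have k: "1 \<le> k" "k \<le> min i j" using True index_bounds by blast+
    have "coord j (down M (Suc j) x) (min i j - k) = coord (Suc j) x (min i (Suc j) - k)"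
    proof (cases "j < i")
      case True
      then show ?thesis using k by (simp add: coord_down_below[OF x] Suc_diff_le)
    next
      case False
      then show ?thesis by (simp add: coord_down_above[OF x])
    qed
    then show ?thesis
      using True k by (auto simp: to_maya_apply[OF down_closed[OF x]] maya_down_apply to_maya_def)
  qed (auto simp: to_maya_apply[OF down_closed[OF x]] maya_down_apply)
  then show "to_maya j (down M (j + 1) x) = down (maya_module A) (j + 1) (to_maya (j + 1) x)"
    by (auto simp: fun_eq_iff)
qed

lemma bij_betw_to_maya: "bij_betw (to_maya j) (piece M j) (piece (maya_module A) j)"
  unfolding bij_betw_def
proof
  show "inj_on (to_maya j) (piece M j)"
  proof (rule inj_onI)
    fix x y assume xy: "x \<in> piece M j" "y \<in> piece M j" "to_maya j x = to_maya j y"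
    show "x = y"
    proof (rule coord_inject[OF xy(1,2)])
      fix m
      show "coord j x m = coord j y m"
      proof (cases "m < min i j")
        case True
        then have "min i j - (min i j - m) = m" "1 \<le> min i j - m" "min i j - m \<le> min i j"
          by linarith+
        then have "to_maya j z (j, min i j - m) = coord j z m" for z
          unfolding to_maya_def by (simp only: prod.case simp_thms if_True)
        then show ?thesis using xy(3) by metis
      next
        case False
        \<comment> \<open>Coordinates outside the window read by \<open>to_maya\<close> vanish on
          the whole piece, so nothing is lost.\<close>
        then have "dim_vector M j \<le> m" using dim_le[of j] by linarith
        then show ?thesis using coord_vanish xy by simp
      qed
    qed
  qed
  show "to_maya j ` piece M j = piece (maya_module A) j"
  proof (intro equalityI subsetI)
    fix g :: "nat \<times> nat \<Rightarrow> 'k" assume g: "g \<in> piece (maya_module A) j"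
    \<comment> \<open>Reading row \<open>j\<close> of \<open>g\<close> backwards gives the only
      possible coordinate sequence; the support of \<open>g\<close> makes it vanish from the
      dimension on, so \<open>coord_image\<close> provides a preimage.\<close>
    define s where "s m = (if m < min i j then g (j, min i j - m) else 0)" for m
    have "s m = 0" if "dim_vector M j \<le> m" for m
    proof (cases "m < min i j")
      case True
      then have "min i j - (min i j - m) = m" "1 \<le> min i j - m" "min i j - m \<le> min i j"
        by linarith+
      then have "(j, min i j - m) \<notin> maya_index A"
        using mem_index_iff that by (metis not_le)
      then have "g (j, min i j - m) = 0" using g by (auto simp: piece_maya_module)
      then show ?thesis by (simp add: s_def)
    qed (auto simp: s_def)
    then have "s \<in> coord j ` piece M j" by (simp add: coord_image)
    then obtain x where x: "x \<in> piece M j" "coord j x = s" by blast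
    have "to_maya j x (l, k) = g (l, k)" for l k
    proof (cases "l = j \<and> (l, k) \<in> maya_index A")
      case True
      then show ?thesis using index_bounds[of j k] x by (auto simp: to_maya_def s_def)
    next
      case False
      then show ?thesis using g x by (auto simp: to_maya_apply piece_maya_module)
    qed
    then have "to_maya j x = g" by (auto simp: fun_eq_iff)
    then show "g \<in> to_maya j ` piece M j" using x by blast
  qed (use to_maya_mem in blast)
qed

end

section \<open>A functional that detects the socle\<close>

context preproj
begin

text \<open>The isomorphism with the simple module makes \<open>U i\<close> a line spanned by the
  preimage \<open>u\<close> of 1 and makes all other \<open>U j\<close> zero. Any functional with
  value 1 at \<open>u\<close> therefore detects the socle.\<close>

lemma functional_from_socle:
  assumes socle: "is_socle U M"
    and iso: "module_iso (restrict_to M U) (simple_at i :: ('k, 'k) graded_rep)"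
  obtains f where "preproj_functional n M i f"
proof -
  obtain \<phi> where lin: "\<And>j. linear_between (smul M) (*) (U j) (piece (simple_at i) j) (\<phi> j)"
    and bij: "\<And>j. bij_betw (\<phi> j) (U j) (piece (simple_at i :: ('k, 'k) graded_rep) j)"
    using iso by (auto simp: module_iso_def module_hom_def restrict_to_def simple_at_def)
  have subU: "subspace (U j)" for j
    using socle by (simp add: is_socle_def submodule_def)
  have "\<phi> i ` U i = UNIV" using bij[of i] by (simp add: bij_betw_def simple_at_def)
  then obtain u where u: "u \<in> U i" "\<phi> i u = 1" by (metis UNIV_I imageE)
  have line: "x = smul M (\<phi> i x) u" if "x \<in> U i" for x
  proof -
    have "\<phi> i (smul M (\<phi> i x) u) = \<phi> i x"
      using lin[of i] u by (simp add: linear_between_def)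
    then show ?thesis
      using bij[of i] that u subspace_scale[OF subU] by (simp add: bij_betw_def inj_on_def)
  qed
  have "u \<noteq> 0"
  proof
    assume "u = 0"
    then have "\<phi> i (smul M 0 u) = 0 * \<phi> i u"
      using lin[of i] u(1) unfolding linear_between_def by blast
    then show False using \<open>u = 0\<close> u by simp
  qed
  interpret scalars: vector_space "(*) :: 'k \<Rightarrow> 'k \<Rightarrow> 'k"
    by unfold_locales (auto simp: algebra_simps)
  interpret vector_space_pair "smul M" "(*) :: 'k \<Rightarrow> 'k \<Rightarrow> 'k" ..
  \<comment> \<open>The functional is extended from the independent set \<open>{u}\<close> to the
    whole ambient vector space, hence is linear on \<open>piece M i\<close>.\<close>
  obtain f where f: "Vector_Spaces.linear (smul M) (*) f" "f u = 1"
    using linear_independent_extend[of "{u}" "\<lambda>_. 1"] \<open>u \<noteq> 0\<close> by (auto simp: dependent_single)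
  interpret f: Vector_Spaces.linear "smul M" "(*)" f by fact
  have "preproj_functional n M i f"
  proof unfold_locales
    show "linear_between (smul M) (*) (piece M i) UNIV f"
      by (simp add: linear_between_def f.add f.scale)
    fix x j
    assume x: "x \<in> piece M (Suc j)" "up M (Suc j) x = 0" "down M (Suc j) x = 0"
      and fx: "Suc j = i \<Longrightarrow> f x = 0"
    have xU: "x \<in> U (Suc j)" using socle_element_mem[OF socle x(1,2)] x(3) by simp
    show "x = 0"
    proof (cases "Suc j = i")
      case True
      then have "x = smul M (\<phi> i x) u" using xU line by blast
      moreover from this have "f x = \<phi> i x" using f by (metis f.scale mult.right_neutral)
      ultimately show ?thesis using fx True by simp
    next
      case False
      then have "\<phi> (Suc j) x = \<phi> (Suc j) 0"
        using bij[of "Suc j"] xU subspace_0[OF subU, of "Suc j"]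
        by (simp add: bij_betw_def simple_at_def) (metis imageI singletonD)
      then show ?thesis
        using bij[of "Suc j"] xU subspace_0[OF subU] by (simp add: bij_betw_def inj_on_def)
    qed
  qed
  then show thesis by (rule that)
qed

end

theorem theorem3p4:
  fixes n i :: nat
    and M :: "('k::field, 'a::ab_group_add) graded_rep"
    and U :: "nat \<Rightarrow> 'a set"
    and A :: "nat set"
  assumes "n \<ge> 2"
    and "i \<in> {1..n-1}"
    and "preproj_module n M"
    and "is_socle U M"
    and "module_iso (restrict_to M U) (simple_at i :: ('k, 'k) graded_rep)"
    and "A \<subseteq> {1..n}"
    and "card A = i"
    and "root_combination n (dim_vector M) = indicator {1..i} - indicator A"
  shows "module_iso M (maya_module A :: ('k, nat \<times> nat \<Rightarrow> 'k) graded_rep)"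
proof -
  interpret preproj n M by unfold_locales fact
  obtain f where "preproj_functional n M i f"
    using assms(4,5) by (rule functional_from_socle)
  then interpret preproj_maya n M i f A
    using assms by (simp add: preproj_maya_def preproj_maya_axioms_def)
  show ?thesis
    unfolding module_iso_def using module_hom_to_maya bij_betw_to_maya by blast
qed

end
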